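(* Let $b>0$, $\sigma>0$, $\alpha,\beta>-1$, $\eta\in\mathbb{R}$, $\mu>0$ with $\alpha-\mu>-1$, and let $N\ge0$ be an integer. Let $x_r:=x_r^{(\alpha,\beta,\sigma)}$, $r=0,\dots,N$, be the mapped Gauss–Jacobi nodes. Define $(N+1)\times(N+1)$ matrices ${}^R\mathbf{V}=({}^rv_{k,i})$ and ${}^R\mathbf{U}=({}^ru_{k,i})$, $k,i=0,\dots,N$, by $${}^rv_{k,i}={}^2\mathcal{J}_i^{(\alpha,\beta,\sigma,\eta)}(x_k),\qquad {}^ru_{k,i}=\frac{\Gamma(i+\alpha+1)}{\Gamma(i+\alpha-\mu+1)}\;{}^2\mathcal{J}_i^{(\alpha-\mu,\beta+\mu,\sigma,\eta+\mu)}(x_k).$$ Then ${}^R\mathbf{V}$ is invertible and the right-sided Erdélyi–Kober fractional differentiation matrix of order $\mu$, i.e. the matrix ${}^R_S\mathbf{D}^\mu=({}^r_sd_{k,i})$ with $${}_xD^\mu_{b,\sigma,\eta}\left[\mathcal{I}_{2,N}u\right](x_k)=\sum_{i=0}^N {}^r_sd_{k,i}\,u(x_i),\qquad k=0,\dots,N,$$ for every continuous function $u$ on $(0,b)$, is given by $${}^R_S\mathbf{D}^\mu={}^R\mathbf{U}\;{}^R\mathbf{V}^{-1}.$$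
   Context: $P_n^{(\alpha,\beta)}$ is the Jacobi polynomial of degree $n$ in the standard normalization $P_n^{(\alpha,\beta)}(1)=\binom{n+\alpha}{n}$. Let $x_r^{(\alpha,\beta)}\in(-1,1)$, $r=0,\dots,N$, be the zeros of $P_{N+1}^{(\alpha,\beta)}$ (Gauss–Jacobi nodes); the mapped nodes are $x_r^{(\alpha,\beta,\sigma)}=b\left(\frac{1+x_r^{(\alpha,\beta)}}2\right)^{1/\sigma}$. Jacobi–Müntz functions of the second kind: ${}^2\mathcal{J}_n^{(\alpha,\beta,\sigma,\eta)}(x)=x^{\sigma\eta}(b^\sigma-x^\sigma)^\alpha P_n^{(\alpha,\beta)}\left(2(x/b)^\sigma-1\right)$. Interpolant: $\mathcal{I}_{2,N}u(x)=\sum_{i=0}^N u(x_i)\left(\frac{x}{x_i}\right)^{\sigma\eta}\left(\frac{b^\sigma-x^\sigma}{b^\sigma-x_i^\sigma}\right)^\alpha h_i^\sigma(x)$ with $h_i^\sigma(x)=\prod_{j\ne i}\frac{x^\sigma-x_j^\sigma}{x_i^\sigma-x_j^\sigma}$. Right Erdélyi–Kober fractional integral (for $\nu>0$) and derivative (for $n-1<\mu\le n$, $n\in\mathbb{N}$): $${}_xI^\nu_{b,\sigma,\eta}[f](x)=\frac{\sigma x^{\sigma\eta}}{\Gamma(\nu)}\int_x^b(t^\sigma-x^\sigma)^{\nu-1}t^{-\sigma(\eta+\nu-1)-1}f(t)\,dt,$$ $${}_xD^\mu_{b,\sigma,\eta}[f](x)=x^{\sigma(\eta+\mu)}\left(\frac{-1}{\sigma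 x^{\sigma-1}}\frac{d}{dx}\right)^n x^{-\sigma(\mu+\eta-n)}\,{}_xI^{n-\mu}_{b,\sigma,\eta+\mu-n}[f](x),$$ with ${}_xI^0$ the identity. *)

theory Defs
  imports "HOL-Analysis.Analysis" "Jordan_Normal_Form.Gauss_Jordan_Elimination"
begin

(* P_n^(alpha,beta)(x) =
     sum_(l<=n) (n+alpha+beta+1)_l (alpha+l+1)_(n-l) / (l! (n-l)!) * ((x-1)/2)^l,
   i.e. (alpha+1)_n/n! * 2F1(-n, n+alpha+beta+1; alpha+1; (1-x)/2) with the division by
   (alpha+1)_l carried out. *)
definition jacobi_poly :: "real \<Rightarrow> real \<Rightarrow> nat \<Rightarrow> real poly" where
  "jacobi_poly \<alpha> \<beta> n =
     (\<Sum>l\<le>n. Polynomial.smult (pochhammer (real n + \<alpha> + \<beta> + 1) l * pochhammer (\<alpha> + real l + 1) (n - l)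
                    / (fact l * fact (n - l)))
              ([:- 1 / 2, 1 / 2:] ^ l))"

lemma poly_jacobi_poly_1: "poly (jacobi_poly \<alpha> \<beta> n) 1 = (real n + \<alpha>) gchoose n"
proof -
  have "poly (jacobi_poly \<alpha> \<beta> n) 1 =
      (\<Sum>l\<le>n. pochhammer (real n + \<alpha> + \<beta> + 1) l * pochhammer (\<alpha> + real l + 1) (n - l)
                    / (fact l * fact (n - l)) * (if l = 0 then 1 else 0))"
    unfolding jacobi_poly_def poly_sum by (intro sum.cong) (auto simp: poly_power)
  also have "\<dots> = pochhammer (\<alpha> + 1) n / fact n"
    by (simp add: sum.delta if_distrib[of "\<lambda>c. _ * c"] cong: if_cong)
  also have "\<dots> = (real n + \<alpha>) gchoose n"
    by (simp add: gbinomial_pochhammer' algebra_simps)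
  finally show ?thesis .
qed

definition gauss_jacobi_nodes :: "real \<Rightarrow> real \<Rightarrow> nat \<Rightarrow> (nat \<Rightarrow> real) \<Rightarrow> bool" where
  "gauss_jacobi_nodes \<alpha> \<beta> N z \<longleftrightarrow>
     bij_betw z {..N} {t. - 1 < t \<and> t < 1 \<and> poly (jacobi_poly \<alpha> \<beta> (Suc N)) t = 0}"

definition jacobi_muntz2 ::
  "real \<Rightarrow> real \<Rightarrow> real \<Rightarrow> real \<Rightarrow> real \<Rightarrow> nat \<Rightarrow> real \<Rightarrow> real" where
  "jacobi_muntz2 b \<alpha> \<beta> \<sigma> \<eta> n x =
     x powr (\<sigma> * \<eta>) * (b powr \<sigma> - x powr \<sigma>) powr \<alpha>
       * poly (jacobi_poly \<alpha> \<beta> n) (2 * (x / b) powr \<sigma> - 1)"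

definition muntz_lagrange :: "real \<Rightarrow> nat \<Rightarrow> (nat \<Rightarrow> real) \<Rightarrow> nat \<Rightarrow> real \<Rightarrow> real" where
  "muntz_lagrange \<sigma> N x i t =
     (\<Prod>j\<in>{..N} - {i}. (t powr \<sigma> - x j powr \<sigma>) / (x i powr \<sigma> - x j powr \<sigma>))"

definition muntz_interpolant2 ::
  "real \<Rightarrow> real \<Rightarrow> real \<Rightarrow> real \<Rightarrow> nat \<Rightarrow> (nat \<Rightarrow> real) \<Rightarrow> (real \<Rightarrow> real) \<Rightarrow> real \<Rightarrow> real" where
  "muntz_interpolant2 b \<alpha> \<sigma> \<eta> N x u t =
     (\<Sum>i\<le>N. u (x i) * (t / x i) powr (\<sigma> * \<eta>)
        * ((b powr \<sigma> - t powr \<sigma>) / (b powr \<sigma> - x i powr \<sigma>)) powr \<alpha>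
        * muntz_lagrange \<sigma> N x i t)"

definition ek_kernel ::
  "real \<Rightarrow> real \<Rightarrow> real \<Rightarrow> (real \<Rightarrow> real) \<Rightarrow> real \<Rightarrow> real \<Rightarrow> real" where
  "ek_kernel \<sigma> \<eta> \<nu> f x t =
     (t powr \<sigma> - x powr \<sigma>) powr (\<nu> - 1) * t powr (- \<sigma> * (\<eta> + \<nu> - 1) - 1) * f t"

definition ek_integral ::
  "real \<Rightarrow> real \<Rightarrow> real \<Rightarrow> real \<Rightarrow> (real \<Rightarrow> real) \<Rightarrow> real \<Rightarrow> real" where
  "ek_integral b \<sigma> \<eta> \<nu> f x =
     (if \<nu> = 0 then f x
      else \<sigma> * x powr (\<sigma> * \<eta>) / Gamma \<nu> * (LINT t:{x..b}|lborel. ek_kernel \<sigma> \<eta> \<nu> f x t))"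

definition ek_step :: "real \<Rightarrow> (real \<Rightarrow> real) \<Rightarrow> real \<Rightarrow> real" where
  "ek_step \<sigma> g x = - 1 / (\<sigma> * x powr (\<sigma> - 1)) * deriv g x"

(* The integer n with n - 1 < mu <= n. *)
definition ek_order :: "real \<Rightarrow> nat" where
  "ek_order \<mu> = nat \<lceil>\<mu>\<rceil>"

definition ek_inner ::
  "real \<Rightarrow> real \<Rightarrow> real \<Rightarrow> real \<Rightarrow> (real \<Rightarrow> real) \<Rightarrow> real \<Rightarrow> real" where
  "ek_inner b \<sigma> \<eta> \<mu> f x = (let n = real (ek_order \<mu>) in
     x powr (- \<sigma> * (\<mu> + \<eta> - n)) * ek_integral b \<sigma> (\<eta> + \<mu> - n) (n - \<mu>) f x)"

definition ek_deriv ::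
  "real \<Rightarrow> real \<Rightarrow> real \<Rightarrow> real \<Rightarrow> (real \<Rightarrow> real) \<Rightarrow> real \<Rightarrow> real" where
  "ek_deriv b \<sigma> \<eta> \<mu> f x =
     x powr (\<sigma> * (\<eta> + \<mu>)) * (ek_step \<sigma> ^^ ek_order \<mu>) (ek_inner b \<sigma> \<eta> \<mu> f) x"

(* Existence of ek_deriv on (0,b): the Lebesgue integral converges absolutely and each of the
   successive derivatives exists. Integrals and derivatives are total functions in HOL, so an
   equation for ek_deriv says nothing about existence. *)
definition ek_differentiable ::
  "real \<Rightarrow> real \<Rightarrow> real \<Rightarrow> real \<Rightarrow> (real \<Rightarrow> real) \<Rightarrow> bool" where
  "ek_differentiable b \<sigma> \<eta> \<mu> f \<longleftrightarrow> (let n = ek_order \<mu> in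
     \<forall>x\<in>{0<..<b}.
       (\<mu> \<noteq> real n \<longrightarrow>
          set_integrable lborel {x..b} (ek_kernel \<sigma> (\<eta> + \<mu> - real n) (real n - \<mu>) f x)) \<and>
       (\<forall>m<n. (ek_step \<sigma> ^^ m) (ek_inner b \<sigma> \<eta> \<mu> f) differentiable (at x)))"

definition ek_diff_matrix ::
  "real \<Rightarrow> real \<Rightarrow> real \<Rightarrow> real \<Rightarrow> real \<Rightarrow> nat \<Rightarrow> (nat \<Rightarrow> real) \<Rightarrow> real mat \<Rightarrow> bool" where
  "ek_diff_matrix b \<alpha> \<sigma> \<eta> \<mu> N x D \<longleftrightarrow>
     D \<in> carrier_mat (N + 1) (N + 1) \<and>
     (\<forall>u. continuous_on {0<..<b} u \<longrightarrow>
        ek_differentiable b \<sigma> \<eta> \<mu> (muntz_interpolant2 b \<alpha> \<sigma> \<eta> N x u) \<and>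
        (\<forall>k\<le>N. ek_deriv b \<sigma> \<eta> \<mu> (muntz_interpolant2 b \<alpha> \<sigma> \<eta> N x u) (x k)
                 = (\<Sum>i\<le>N. D $$ (k, i) * u (x i))))"

definition ek_V_mat ::
  "real \<Rightarrow> real \<Rightarrow> real \<Rightarrow> real \<Rightarrow> real \<Rightarrow> nat \<Rightarrow> (nat \<Rightarrow> real) \<Rightarrow> real mat" where
  "ek_V_mat b \<alpha> \<beta> \<sigma> \<eta> N x =
     Matrix.mat (N + 1) (N + 1) (\<lambda>(k, i). jacobi_muntz2 b \<alpha> \<beta> \<sigma> \<eta> i (x k))"

definition ek_U_mat ::
  "real \<Rightarrow> real \<Rightarrow> real \<Rightarrow> real \<Rightarrow> real \<Rightarrow> real \<Rightarrow> nat \<Rightarrow> (nat \<Rightarrow> real) \<Rightarrow> real mat" where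
  "ek_U_mat b \<alpha> \<beta> \<sigma> \<eta> \<mu> N x =
     Matrix.mat (N + 1) (N + 1) (\<lambda>(k, i).
       Gamma (real i + \<alpha> + 1) / Gamma (real i + \<alpha> - \<mu> + 1)
         * jacobi_muntz2 b (\<alpha> - \<mu>) (\<beta> + \<mu>) \<sigma> (\<eta> + \<mu>) i (x k))"

end

theory Submission
  imports Defs "Jordan_Normal_Form.Determinant"
begin

text \<open>Write \<open>B = b powr \<sigma>\<close> and \<open>X = x powr \<sigma>\<close>. The substitution \<open>s = t powr \<sigma>\<close> turns the
  Erdelyi-Kober integral of \<open>X powr \<eta> * (B - X) powr \<gamma>\<close> into a Beta integral, and each of the \<open>n\<close> steps of
  the derivative lowers the exponent of \<open>B - X\<close> by one, so that the function is mapped to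
  \<open>Gamma (\<gamma> + 1) / Gamma (\<gamma> - \<mu> + 1) * X powr (\<eta> + \<mu>) * (B - X) powr (\<gamma> - \<mu>)\<close>.
  The expansion of a Jacobi polynomial about 1 has exponents \<open>\<gamma> = \<alpha> + l\<close>, and these Gamma quotients
  change its coefficients into those with parameters \<open>\<alpha> - \<mu>\<close>, \<open>\<beta> + \<mu>\<close>, up to one factor that depends
  only on the degree. Up to the common weight \<open>X powr \<eta> * (B - X) powr \<alpha>\<close>, the interpolant is a polynomial
  of degree at most \<open>N\<close> in \<open>X\<close>, hence the combination of Jacobi-Muntz functions with coefficient vector
  \<open>V\<close> inverse times the vector of nodal values.\<close>

section \<open>Erdelyi-Kober operators on sums of powers of
  \<open>b powr \<sigma> - t powr \<sigma>\<close>\<close>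

text \<open>The map \<open>g\<close>, affine in \<open>t powr \<sigma>\<close>, sends
  \<open>{x..b}\<close> bijectively onto \<open>{0..1}\<close> and turns the integrand into a
  constant multiple of the Beta integrand \<open>h\<close>. The change of variables for absolute
  integrals then yields integrability and value at once.\<close>

lemma powr_Beta_integral:
  fixes x b \<sigma> \<nu> \<gamma> :: real
  assumes "0 < x" "x < b" "0 < \<sigma>" "0 < \<nu>" "- 1 < \<gamma>"
  defines "f \<equiv> \<lambda>t. (t powr \<sigma> - x powr \<sigma>) powr (\<nu> - 1) * t powr (\<sigma> - 1) * (b powr \<sigma> - t powr \<sigma>) powr \<gamma>"
  shows "set_integrable lborel {x..b} f"
    and "(LINT t:{x..b}|lborel. f t) =
           (b powr \<sigma> - x powr \<sigma>) powr (\<gamma> + \<nu>) * Beta \<nu> (\<gamma> + 1) / \<sigma>"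
proof -
  define L where "L = b powr \<sigma> - x powr \<sigma>"
  define g where "g = (\<lambda>t. (t powr \<sigma> - x powr \<sigma>) / L)"
  define h where "h = (\<lambda>s::real. s powr (\<nu> - 1) * (1 - s) powr \<gamma>)"
  have mono: "s powr \<sigma> < t powr \<sigma>" if "0 < s" "s < t" for s t
    using that assms(3) by (simp add: powr_less_mono2)
  have L: "L > 0"
    using mono[of x b] assms by (simp add: L_def)
  have deriv: "(g has_field_derivative \<sigma> * t powr (\<sigma> - 1) / L) (at t within {x..b})"
    if "t \<in> {x..b}" for t
    unfolding g_def using that assms L by (auto intro!: derivative_eq_intros simp: field_simps)
  have inj: "inj_on g {x..b}"
  proof (rule linorder_inj_onI')
    fix s t assume "s \<in> {x..b}" "t \<in> {x..b}" "s < t"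
    then show "g s \<noteq> g t"
      using mono[of s t] assms L by (auto simp: g_def)
  qed
  have image: "g ` {x..b} = {0..1}"
  proof (intro equalityI subsetI)
    fix y assume "y \<in> g ` {x..b}"
    then obtain t where t: "x \<le> t" "t \<le> b" "y = g t" by auto
    then have "x powr \<sigma> \<le> t powr \<sigma>" "t powr \<sigma> \<le> b powr \<sigma>"
      using assms by (auto intro!: powr_mono2)
    then show "y \<in> {0..1}"
      using L unfolding t(3) g_def by (auto simp: L_def)
  next
    fix y :: real assume y: "y \<in> {0..1}"
    have "continuous_on {x..b} g"
      using deriv by (meson DERIV_continuous_on)
    moreover have "g x \<le> y" "y \<le> g b"
      using y L by (auto simp: g_def L_def)
    ultimately show "y \<in> g ` {x..b}"
      using IVT'[of g x y b] assms by force
  qed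
  have h_int: "(h has_integral Beta \<nu> (\<gamma> + 1)) {0..1}"
    unfolding h_def using has_integral_Beta_real[of \<nu> "\<gamma> + 1"] assms by simp
  have "h absolutely_integrable_on {0..1}"
    using h_int by (intro nonnegative_absolutely_integrable_1) (auto simp: h_def)
  then have sub:
    "(\<lambda>t. \<bar>\<sigma> * t powr (\<sigma> - 1) / L\<bar> * h (g t)) absolutely_integrable_on {x..b} \<and>
     integral {x..b} (\<lambda>t. \<bar>\<sigma> * t powr (\<sigma> - 1) / L\<bar> * h (g t)) = Beta \<nu> (\<gamma> + 1)"
    using h_int image
    by (subst has_absolute_integral_change_of_variables_1'[OF _ deriv inj]) auto
  \<comment> \<open>One power of \<open>L\<close> comes from the derivative of \<open>g\<close>, the
    others from normalising the two factors of \<open>h\<close>. The identity includes both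
    endpoints, where \<open>0 powr c = 0\<close> makes each side vanish.\<close>
  have eq: "f t = L powr (\<gamma> + \<nu>) / \<sigma> * (\<bar>\<sigma> * t powr (\<sigma> - 1) / L\<bar> * h (g t))"
    if "t \<in> {x..b}" for t
  proof -
    have t: "0 \<le> t powr \<sigma> - x powr \<sigma>" "0 \<le> b powr \<sigma> - t powr \<sigma>"
      using that assms by (auto intro!: powr_mono2)
    have "1 - g t = (b powr \<sigma> - t powr \<sigma>) / L"
      using L by (simp add: g_def L_def field_simps)
    then have "h (g t) = (t powr \<sigma> - x powr \<sigma>) powr (\<nu> - 1) * (b powr \<sigma> - t powr \<sigma>) powr \<gamma>
                 / (L powr (\<nu> - 1) * L powr \<gamma>)"
      using t L by (simp add: h_def g_def powr_divide)
    moreover have "L powr (\<gamma> + \<nu>) = L * (L powr (\<nu> - 1) * L powr \<gamma>)"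
      using L powr_add[of L 1 "\<nu> - 1 + \<gamma>"] by (simp add: powr_add[symmetric] add_ac)
    ultimately show ?thesis
      using L assms by (simp add: f_def)
  qed
  have "f absolutely_integrable_on {x..b} \<longleftrightarrow>
      (\<lambda>t. L powr (\<gamma> + \<nu>) / \<sigma> * (\<bar>\<sigma> * t powr (\<sigma> - 1) / L\<bar> * h (g t))) absolutely_integrable_on {x..b}"
    by (rule set_integrable_cong) (simp_all only: eq)
  then have abs: "f absolutely_integrable_on {x..b}"
    using sub by (auto intro: set_integrable_mult_right)
  have val: "integral {x..b} f = L powr (\<gamma> + \<nu>) * Beta \<nu> (\<gamma> + 1) / \<sigma>"
  proof -
    have "integral {x..b} f =
        integral {x..b} (\<lambda>t. L powr (\<gamma> + \<nu>) / \<sigma> * (\<bar>\<sigma> * t powr (\<sigma> - 1) / L\<bar> * h (g t)))"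
      by (rule integral_cong) (simp only: eq)
    also have "\<dots> = L powr (\<gamma> + \<nu>) / \<sigma> * Beta \<nu> (\<gamma> + 1)"
      using sub by (subst integral_mult_right) simp
    finally show ?thesis by simp
  qed
  \<comment> \<open>\<open>absolutely_integrable_on\<close> refers to the completion of
    \<open>lborel\<close>; Borel measurability carries integrability and value back to
    \<open>lborel\<close>.\<close>
  have meas: "(\<lambda>t. indicat_real {x..b} t *\<^sub>R f t) \<in> borel_measurable lborel"
    unfolding f_def by measurable
  show "set_integrable lborel {x..b} f"
    using abs meas by (simp add: set_integrable_def integrable_completion)
  have "(LINT t:{x..b}|lborel. f t) = (LINT t:{x..b}|lebesgue. f t)"
    using meas by (simp add: set_lebesgue_integral_def integral_completion)
  also have "\<dots> = integral {x..b} f"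
    by (rule set_lebesgue_integral_eq_integral(2)[OF abs])
  finally show "(LINT t:{x..b}|lborel. f t) =
           (b powr \<sigma> - x powr \<sigma>) powr (\<gamma> + \<nu>) * Beta \<nu> (\<gamma> + 1) / \<sigma>"
    by (simp add: val L_def)
qed

text \<open>Only the values of \<open>f\<close> on \<open>(0, b]\<close> are prescribed, so a
  function defined by another formula fits as soon as it agrees there. The bound on
  \<open>\<gamma> s - \<mu>\<close> keeps each exponent positive as long as a derivative remains to
  be taken.\<close>

locale ek_power_sum =
  fixes b \<sigma> \<eta> \<mu> :: real and f :: "real \<Rightarrow> real" and S :: "'s set" and a \<gamma> :: "'s \<Rightarrow> real"
  assumes b: "b > 0" and \<sigma>: "\<sigma> > 0" and \<mu>: "\<mu> > 0"
    and \<gamma>: "\<And>s. s \<in> S \<Longrightarrow> \<gamma> s - \<mu> > - 1"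
    and f: "\<And>t. 0 < t \<Longrightarrow> t \<le> b \<Longrightarrow>
              f t = t powr (\<sigma> * \<eta>) * (\<Sum>s\<in>S. a s * (b powr \<sigma> - t powr \<sigma>) powr \<gamma> s)"
begin

text \<open>The closed form after \<open>m\<close> derivative steps. The exponent starts at
  \<open>\<gamma> s + (ek_order \<mu> - \<mu>)\<close> and drops by one per step, so it ends at
  \<open>\<gamma> s - \<mu>\<close> for \<open>m = ek_order \<mu>\<close>; the Gamma quotient
  collects the factors that differentiation brings down.\<close>

definition step_sum :: "nat \<Rightarrow> real \<Rightarrow> real" where
  "step_sum m x = (\<Sum>s\<in>S. a s * (Gamma (\<gamma> s + 1) / Gamma (\<gamma> s + (ek_order \<mu> - \<mu>) - m + 1)) *
             (b powr \<sigma> - x powr \<sigma>) powr (\<gamma> s + (ek_order \<mu> - \<mu>) - m))"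

lemma order_gap: "0 \<le> real (ek_order \<mu>) - \<mu>"
  using \<mu> by (simp add: ek_order_def)

text \<open>\<open>\<eta> - \<nu>\<close> is the parameter at which \<open>ek_inner\<close> calls
  the integral. There the powers of \<open>t\<close> in the kernel and in \<open>f\<close> combine
  to \<open>t powr (\<sigma> - 1)\<close>, so each term is an instance of the Beta integral.\<close>

lemma kernel:
  assumes "0 < x" "x < b" "\<nu> = real (ek_order \<mu>) - \<mu>" "0 < \<nu>"
  shows "set_integrable lborel {x..b} (ek_kernel \<sigma> (\<eta> - \<nu>) \<nu> f x)"
    and "(LINT t:{x..b}|lborel. ek_kernel \<sigma> (\<eta> - \<nu>) \<nu> f x t) = Gamma \<nu> / \<sigma> * step_sum 0 x"
proof -
  let ?k = "\<lambda>s t. a s * ((t powr \<sigma> - x powr \<sigma>) powr (\<nu> - 1) * t powr (\<sigma> - 1)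
              * (b powr \<sigma> - t powr \<sigma>) powr \<gamma> s)"
  have eq: "ek_kernel \<sigma> (\<eta> - \<nu>) \<nu> f x t = (\<Sum>s\<in>S. ?k s t)" if "t \<in> {x..b}" for t
  proof -
    have "t powr (- \<sigma> * (\<eta> - \<nu> + \<nu> - 1) - 1) * t powr (\<sigma> * \<eta>) = t powr (\<sigma> - 1)"
      by (simp add: powr_add[symmetric] algebra_simps)
    then have "ek_kernel \<sigma> (\<eta> - \<nu>) \<nu> f x t = (t powr \<sigma> - x powr \<sigma>) powr (\<nu> - 1) *
        (t powr (\<sigma> - 1) * (\<Sum>s\<in>S. a s * (b powr \<sigma> - t powr \<sigma>) powr \<gamma> s))"
      using that assms f[of t] by (simp only: ek_kernel_def) (simp add: mult.assoc[symmetric])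
    then show ?thesis
      by (simp add: sum_distrib_left mult_ac)
  qed
  have \<gamma>': "- 1 < \<gamma> s" if "s \<in> S" for s
    using \<gamma>[OF that] \<mu> by simp
  note beta = powr_Beta_integral[OF assms(1,2) \<sigma> assms(4) \<gamma>']
  have int: "set_integrable lborel {x..b} (?k s)" if "s \<in> S" for s
    using beta(1)[OF that] by (auto intro: set_integrable_mult_right)
  have "set_integrable lborel {x..b} (ek_kernel \<sigma> (\<eta> - \<nu>) \<nu> f x) \<longleftrightarrow>
        set_integrable lborel {x..b} (\<lambda>t. \<Sum>s\<in>S. ?k s t)"
    by (rule set_integrable_cong) (simp_all only: eq)
  moreover have "set_integrable lborel {x..b} (\<lambda>t. \<Sum>s\<in>S. ?k s t)"
    using int unfolding set_integrable_def scaleR_sum_right by (intro Bochner_Integration.integrable_sum)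
  ultimately show "set_integrable lborel {x..b} (ek_kernel \<sigma> (\<eta> - \<nu>) \<nu> f x)" by blast
  have "(LINT t:{x..b}|lborel. ek_kernel \<sigma> (\<eta> - \<nu>) \<nu> f x t) = (LINT t:{x..b}|lborel. \<Sum>s\<in>S. ?k s t)"
    by (rule set_lebesgue_integral_cong) (simp, intro allI impI eq)
  also have "\<dots> = (\<Sum>s\<in>S. LINT t:{x..b}|lborel. ?k s t)"
    using int unfolding set_integrable_def set_lebesgue_integral_def scaleR_sum_right
    by (intro Bochner_Integration.integral_sum)
  also have "\<dots> = (\<Sum>s\<in>S. Gamma \<nu> / \<sigma> * (a s * (Gamma (\<gamma> s + 1) / Gamma (\<gamma> s + \<nu> + 1)) *
             (b powr \<sigma> - x powr \<sigma>) powr (\<gamma> s + \<nu>)))"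
    using beta(2) by (intro sum.cong refl) (simp add: Beta_def add_ac mult_ac)
  also have "\<dots> = Gamma \<nu> / \<sigma> * step_sum 0 x"
    by (simp add: step_sum_def sum_distrib_left assms(3))
  finally show "(LINT t:{x..b}|lborel. ek_kernel \<sigma> (\<eta> - \<nu>) \<nu> f x t) = Gamma \<nu> / \<sigma> * step_sum 0 x" .
qed

lemma ek_inner_eq:
  assumes "0 < x" "x < b"
  shows "ek_inner b \<sigma> \<eta> \<mu> f x = step_sum 0 x"
proof -
  define \<nu> where "\<nu> = real (ek_order \<mu>) - \<mu>"
  have E: "\<mu> + \<eta> - real (ek_order \<mu>) = \<eta> - \<nu>" "\<eta> + \<mu> - real (ek_order \<mu>) = \<eta> - \<nu>"
    by (simp_all add: \<nu>_def)
  have nz: "x powr (- \<sigma> * c) * x powr (\<sigma> * c) = 1" for c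
    using assms by (simp add: powr_add[symmetric])
  show ?thesis
  proof (cases "\<nu> = 0")
    \<comment> \<open>For integer \<open>\<mu>\<close> the integral is the identity by definition,
      and the Gamma quotients in \<open>step_sum 0\<close> equal 1 because
      \<open>Gamma (\<gamma> s + 1)\<close> is nonzero.\<close>
    case True
    have "step_sum 0 x = (\<Sum>s\<in>S. a s * (b powr \<sigma> - x powr \<sigma>) powr \<gamma> s)"
      unfolding step_sum_def
    proof (intro sum.cong refl)
      fix s assume "s \<in> S"
      then have "Gamma (\<gamma> s + 1) > 0"
        using \<gamma>[of s] \<mu> by (intro Gamma_real_pos) simp
      then show "a s * (Gamma (\<gamma> s + 1) / Gamma (\<gamma> s + (ek_order \<mu> - \<mu>) - real 0 + 1)) *
             (b powr \<sigma> - x powr \<sigma>) powr (\<gamma> s + (ek_order \<mu> - \<mu>) - real 0) =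
             a s * (b powr \<sigma> - x powr \<sigma>) powr \<gamma> s"
        using True by (simp add: \<nu>_def)
    qed
    then show ?thesis
      using True nz[of \<eta>] assms f[of x]
      unfolding ek_inner_def Let_def E \<nu>_def[symmetric] ek_integral_def
      by (simp add: mult.assoc[symmetric])
  next
    case False
    then have "0 < \<nu>" using order_gap by (simp add: \<nu>_def)
    have "Gamma \<nu> > 0" using \<open>0 < \<nu>\<close> by simp
    then show ?thesis
      using False nz[of "\<eta> - \<nu>"] \<sigma>
      unfolding ek_inner_def Let_def E \<nu>_def[symmetric] ek_integral_def
      by (simp add: kernel(2)[OF assms \<nu>_def \<open>0 < \<nu>\<close>] mult.assoc[symmetric])
  qed
qed

text \<open>From \<open>m + 1 \<le> ek_order \<mu>\<close> and
  \<open>\<gamma> s - \<mu> > - 1\<close> the exponent \<open>\<delta> s\<close> is positive. Hence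
  \<open>Gamma (\<delta> s + 1) = \<delta> s * Gamma (\<delta> s)\<close>, which absorbs the factor
  \<open>\<delta> s\<close> produced by differentiation.\<close>

lemma step_sum_deriv:
  assumes "0 < x" "x < b" "m < ek_order \<mu>"
  shows "(step_sum m has_field_derivative - \<sigma> * x powr (\<sigma> - 1) * step_sum (Suc m) x) (at x)"
proof -
  have B: "b powr \<sigma> - x powr \<sigma> > 0"
    using assms \<sigma> by (simp add: powr_less_mono2)
  define \<delta> where "\<delta> s = \<gamma> s + (real (ek_order \<mu>) - \<mu>) - m" for s
  have \<delta>: "\<delta> s > 0" if "s \<in> S" for s
  proof -
    have "real m + 1 \<le> real (ek_order \<mu>)" using assms by linarith
    then show ?thesis using \<gamma>[OF that] by (simp add: \<delta>_def)
  qed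
  then have "Gamma (\<delta> s + 1) \<noteq> 0" if "s \<in> S" for s
    using that by (intro less_imp_neq[THEN not_sym] Gamma_real_pos) (simp add: add_pos_pos)
  have "(step_sum m has_field_derivative
      (\<Sum>s\<in>S. a s * (Gamma (\<gamma> s + 1) / Gamma (\<delta> s + 1)) *
          (\<delta> s * (b powr \<sigma> - x powr \<sigma>) powr (\<delta> s - 1) * (- \<sigma> * x powr (\<sigma> - 1))))) (at x)"
    unfolding step_sum_def \<delta>_def[symmetric] using assms B \<open>\<And>s. s \<in> S \<Longrightarrow> Gamma (\<delta> s + 1) \<noteq> 0\<close>
    by (auto intro!: derivative_eq_intros sum.cong simp: mult_ac)
  also have "(\<Sum>s\<in>S. a s * (Gamma (\<gamma> s + 1) / Gamma (\<delta> s + 1)) *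
          (\<delta> s * (b powr \<sigma> - x powr \<sigma>) powr (\<delta> s - 1) * (- \<sigma> * x powr (\<sigma> - 1)))) =
      - \<sigma> * x powr (\<sigma> - 1) * step_sum (Suc m) x"
    unfolding step_sum_def sum_distrib_left
  proof (intro sum.cong refl)
    fix s assume s: "s \<in> S"
    have "Gamma (\<delta> s + 1) = \<delta> s * Gamma (\<delta> s)" "Gamma (\<delta> s) > 0"
      by (use \<delta>[OF s] in \<open>auto intro!: Gamma_plus1 elim!: nonpos_Ints_cases\<close>)
    moreover have shift: "\<gamma> s + (real (ek_order \<mu>) - \<mu>) - real (Suc m) = \<delta> s - 1"
      by (simp add: \<delta>_def)
    ultimately show "a s * (Gamma (\<gamma> s + 1) / Gamma (\<delta> s + 1)) *
          (\<delta> s * (b powr \<sigma> - x powr \<sigma>) powr (\<delta> s - 1) * (- \<sigma> * x powr (\<sigma> - 1))) =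
        - \<sigma> * x powr (\<sigma> - 1) * (a s * (Gamma (\<gamma> s + 1) /
            Gamma (\<gamma> s + (real (ek_order \<mu>) - \<mu>) - real (Suc m) + 1)) *
          (b powr \<sigma> - x powr \<sigma>) powr (\<gamma> s + (real (ek_order \<mu>) - \<mu>) - real (Suc m)))"
      unfolding shift using \<delta>[OF s] by simp
  qed
  finally show ?thesis .
qed

lemma ek_step_iterate:
  assumes "m \<le> ek_order \<mu>" "0 < x" "x < b"
  shows "(ek_step \<sigma> ^^ m) (ek_inner b \<sigma> \<eta> \<mu> f) x = step_sum m x"
  using assms
proof (induction m arbitrary: x)
  case 0
  then show ?case by (simp add: ek_inner_eq)
next
  case (Suc m)
  let ?h = "(ek_step \<sigma> ^^ m) (ek_inner b \<sigma> \<eta> \<mu> f)"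
  \<comment> \<open>The derivative needs equality near \<open>x\<close>, not only at
    \<open>x\<close>; the induction hypothesis provides it on the open interval.\<close>
  have "\<forall>\<^sub>F y in nhds x. y \<in> {0<..<b}"
    using Suc.prems by (intro eventually_nhds_in_open) auto
  then have "\<forall>\<^sub>F y in nhds x. ?h y = step_sum m y"
    by eventually_elim (use Suc in auto)
  then have "deriv ?h x = deriv (step_sum m) x"
    by (rule deriv_cong_ev) simp
  also have "\<dots> = - \<sigma> * x powr (\<sigma> - 1) * step_sum (Suc m) x"
    using step_sum_deriv[of x m] Suc.prems by (intro DERIV_imp_deriv) auto
  finally show ?case
    using \<sigma> Suc.prems by (simp add: ek_step_def[of \<sigma> ?h])
qed

lemma ek_differentiable: "ek_differentiable b \<sigma> \<eta> \<mu> f"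
  unfolding ek_differentiable_def Let_def
proof (intro ballI conjI impI allI)
  fix x assume x: "x \<in> {0<..<b}"
  {
    assume "\<mu> \<noteq> real (ek_order \<mu>)"
    then show "set_integrable lborel {x..b}
        (ek_kernel \<sigma> (\<eta> + \<mu> - real (ek_order \<mu>)) (real (ek_order \<mu>) - \<mu>) f x)"
      using kernel(1)[of x "real (ek_order \<mu>) - \<mu>"] x order_gap by (simp add: algebra_simps)
  next
    fix m assume m: "m < ek_order \<mu>"
    have "(step_sum m has_field_derivative - \<sigma> * x powr (\<sigma> - 1) * step_sum (Suc m) x) (at x)"
      using step_sum_deriv x m by auto
    then have "((ek_step \<sigma> ^^ m) (ek_inner b \<sigma> \<eta> \<mu> f) has_field_derivative
        - \<sigma> * x powr (\<sigma> - 1) * step_sum (Suc m) x) (at x)"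
      by (rule has_field_derivative_transform_within_open[of _ _ _ "{0<..<b}"])
        (use x m ek_step_iterate in auto)
    then show "(ek_step \<sigma> ^^ m) (ek_inner b \<sigma> \<eta> \<mu> f) differentiable (at x)"
      by (auto simp: real_differentiable_def)
  }
qed

lemma ek_deriv_eq:
  assumes "0 < x" "x < b"
  shows "ek_deriv b \<sigma> \<eta> \<mu> f x = x powr (\<sigma> * (\<eta> + \<mu>)) *
    (\<Sum>s\<in>S. a s * (Gamma (\<gamma> s + 1) / Gamma (\<gamma> s - \<mu> + 1)) * (b powr \<sigma> - x powr \<sigma>) powr (\<gamma> s - \<mu>))"
  using assms by (simp add: ek_deriv_def ek_step_iterate step_sum_def)

end

section \<open>Jacobi polynomials expanded about 1\<close>

definition jacobi_coeff :: "real \<Rightarrow> real \<Rightarrow> nat \<Rightarrow> nat \<Rightarrow> real" where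
  "jacobi_coeff \<alpha> \<beta> n l =
     pochhammer (real n + \<alpha> + \<beta> + 1) l * pochhammer (\<alpha> + real l + 1) (n - l) / (fact l * fact (n - l))"

lemma jacobi_poly_eq_sum:
  "jacobi_poly \<alpha> \<beta> n = (\<Sum>l\<le>n. Polynomial.smult (jacobi_coeff \<alpha> \<beta> n l) ([:- 1 / 2, 1 / 2:] ^ l))"
  by (simp add: jacobi_poly_def jacobi_coeff_def)

lemma degree_half_power: "degree ([:- (1 / 2), 1 / 2 :: real:] ^ l) = l"
  by (simp add: degree_power_eq)

lemma degree_jacobi_poly_le: "degree (jacobi_poly \<alpha> \<beta> n) \<le> n"
  unfolding jacobi_poly_eq_sum
  by (intro degree_sum_le) (auto intro: order.trans[OF degree_smult_le] simp: degree_half_power)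

text \<open>Only the term \<open>l = n\<close> reaches degree \<open>n\<close>, so the leading
  coefficient is governed by \<open>pochhammer (real n + \<alpha> + \<beta> + 1) n\<close>.\<close>

lemma coeff_jacobi_poly_nonzero:
  assumes "\<alpha> > - 1" "\<beta> > - 1"
  shows "poly.coeff (jacobi_poly \<alpha> \<beta> n) n \<noteq> 0"
proof -
  have "poly.coeff (jacobi_poly \<alpha> \<beta> n) n =
      (\<Sum>l\<le>n. if l = n then jacobi_coeff \<alpha> \<beta> n n * (1 / 2) ^ n else 0)"
    unfolding jacobi_poly_eq_sum coeff_sum
  proof (intro sum.cong refl)
    fix l assume "l \<in> {..n}"
    then show "poly.coeff (Polynomial.smult (jacobi_coeff \<alpha> \<beta> n l) ([:- 1 / 2, 1 / 2:] ^ l)) n =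
        (if l = n then jacobi_coeff \<alpha> \<beta> n n * (1 / 2) ^ n else 0)"
      using lead_coeff_power[of "[:- 1 / 2, 1 / 2 :: real:]" n, simplified, unfolded degree_half_power]
      by (auto simp: degree_half_power intro!: coeff_eq_0)
  qed
  also have "\<dots> = jacobi_coeff \<alpha> \<beta> n n * (1 / 2) ^ n"
    by simp
  also have "\<dots> \<noteq> 0"
  \<comment> \<open>For \<open>n \<ge> 1\<close> the bound \<open>\<alpha> + \<beta> > - 2\<close>
    makes the base of the Pochhammer symbol positive. For \<open>n = 0\<close> the base may be
    negative, but the product is empty.\<close>
  proof (cases n)
    case (Suc m)
    then have "pochhammer (real n + \<alpha> + \<beta> + 1) n > 0"
      using assms by (intro pochhammer_pos) simp
    then show ?thesis by (simp add: jacobi_coeff_def)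
  qed (simp add: jacobi_coeff_def)
  finally show ?thesis .
qed

text \<open>The coefficient of highest degree receives a contribution only from the last polynomial,
  so its scalar vanishes; induction removes the others in turn.\<close>

lemma graded_poly_independent:
  fixes p :: "nat \<Rightarrow> 'a::field poly"
  assumes "\<And>i. degree (p i) \<le> i" "\<And>i. poly.coeff (p i) i \<noteq> 0"
    and "(\<Sum>i\<le>n. Polynomial.smult (c i) (p i)) = 0" "i \<le> n"
  shows "c i = 0"
  using assms(3,4)
proof (induction n arbitrary: i)
  case 0
  then show ?case using assms(2)[of 0] by auto
next
  case (Suc n)
  have "degree (\<Sum>i\<le>n. Polynomial.smult (c i) (p i)) \<le> n"
    by (intro degree_sum_le) (auto intro: order.trans[OF degree_smult_le] order.trans[OF assms(1)])
  then have "poly.coeff (\<Sum>i\<le>Suc n. Polynomial.smult (c i) (p i)) (Suc n)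
      = c (Suc n) * poly.coeff (p (Suc n)) (Suc n)"
    by (simp add: coeff_eq_0)
  then have "c (Suc n) * poly.coeff (p (Suc n)) (Suc n) = 0"
    unfolding Suc.prems(1) by simp
  then have "c (Suc n) = 0"
    using assms(2)[of "Suc n"] by simp
  then show ?case
    using Suc by (cases "i = Suc n") auto
qed

section \<open>Fractional derivatives of Jacobi-Muntz functions\<close>

text \<open>At the argument \<open>2 * (t / b) powr \<sigma> - 1\<close> the expansion variable,
  half the distance from 1 with negative sign, is \<open>- d / b powr \<sigma>\<close>, whose powers
  merge with the weight \<open>d powr \<alpha>\<close>.\<close>

lemma jacobi_muntz2_eq_sum:
  assumes "0 < b" "0 < \<sigma>" "0 < t" "t \<le> b"
  shows "jacobi_muntz2 b \<alpha> \<beta> \<sigma> \<eta> n t = t powr (\<sigma> * \<eta>) *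
    (\<Sum>l\<le>n. jacobi_coeff \<alpha> \<beta> n l * (- 1 / b powr \<sigma>) ^ l * (b powr \<sigma> - t powr \<sigma>) powr (\<alpha> + real l))"
proof -
  define d where "d = b powr \<sigma> - t powr \<sigma>"
  have "d \<ge> 0"
    using assms by (auto simp: d_def intro!: powr_mono2)
  \<comment> \<open>The case \<open>d = 0\<close> is \<open>t = b\<close>, where both sides are 0,
    even for \<open>l = 0\<close>, since \<open>0 powr \<alpha> = 0\<close>.\<close>
  then have d: "d powr \<alpha> * d ^ l = d powr (\<alpha> + real l)" for l
    by (cases "d = 0") (auto simp: powr_add powr_realpow)
  have "poly [:- 1 / 2, 1 / 2:] (2 * (t / b) powr \<sigma> - 1) = - 1 / b powr \<sigma> * d"
    using assms by (simp add: powr_divide d_def field_simps)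
  then have "poly (jacobi_poly \<alpha> \<beta> n) (2 * (t / b) powr \<sigma> - 1) =
      (\<Sum>l\<le>n. jacobi_coeff \<alpha> \<beta> n l * ((- 1 / b powr \<sigma>) ^ l * d ^ l))"
    by (simp only: jacobi_poly_eq_sum poly_sum poly_smult poly_power power_mult_distrib)
  then show ?thesis
    unfolding jacobi_muntz2_def d_def[symmetric] d[symmetric]
    by (simp only: sum_distrib_left mult_ac)
qed

text \<open>The second Pochhammer symbol is \<open>Gamma (real n + \<alpha> + 1) / Gamma (\<alpha> +
  real l + 1)\<close>, so the quotient on the left cancels its dependence on \<open>l\<close> and
  supplies that for \<open>\<alpha> - \<mu>\<close>. The first Pochhammer symbol depends on
  \<open>\<alpha> + \<beta>\<close> alone, which the shift preserves.\<close>

lemma jacobi_coeff_shift: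
  assumes "\<alpha> > - 1" "\<alpha> - \<mu> > - 1" "l \<le> n"
  shows "jacobi_coeff \<alpha> \<beta> n l * (Gamma (\<alpha> + real l + 1) / Gamma (\<alpha> + real l - \<mu> + 1)) =
    Gamma (real n + \<alpha> + 1) / Gamma (real n + \<alpha> - \<mu> + 1) * jacobi_coeff (\<alpha> - \<mu>) (\<beta> + \<mu>) n l"
proof -
  have poch: "pochhammer (a + real l + 1) (n - l) * Gamma (a + real l + 1) = Gamma (real n + a + 1)"
    and pos: "Gamma (a + real l + 1) > 0" "Gamma (real n + a + 1) > 0" if "a > - 1" for a
  proof -
    show pos: "Gamma (a + real l + 1) > 0" "Gamma (real n + a + 1) > 0"
      using that by (auto intro!: Gamma_real_pos)
    have "a + real l + 1 \<notin> \<int>\<^sub>\<le>\<^sub>0"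
      using that by (auto elim!: nonpos_Ints_cases)
    then show "pochhammer (a + real l + 1) (n - l) * Gamma (a + real l + 1) = Gamma (real n + a + 1)"
      using pos assms(3) by (simp add: pochhammer_Gamma of_nat_diff add_ac)
  qed
  have "pochhammer (\<alpha> + real l + 1) (n - l) * (Gamma (\<alpha> + real l + 1) / Gamma (\<alpha> - \<mu> + real l + 1)) =
      Gamma (real n + \<alpha> + 1) / Gamma (real n + (\<alpha> - \<mu>) + 1) * pochhammer (\<alpha> - \<mu> + real l + 1) (n - l)"
    using pos[OF assms(2)] by (auto simp: poch[OF assms(1), symmetric] poch[OF assms(2), symmetric])
  moreover have "real n + (\<alpha> - \<mu>) + (\<beta> + \<mu>) + 1 = real n + \<alpha> + \<beta> + 1"
    "real n + (\<alpha> - \<mu>) + 1 = real n + \<alpha> - \<mu> + 1" "\<alpha> - \<mu> + real l + 1 = \<alpha> + real l - \<mu> + 1"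
    by simp_all
  ultimately show ?thesis
    unfolding jacobi_coeff_def by (simp only: times_divide_eq_left mult.assoc) (simp add: mult_ac)
qed

lemma ek_deriv_jacobi_muntz2_sum:
  fixes f :: "real \<Rightarrow> real"
  assumes "0 < b" "0 < \<sigma>" "0 < \<mu>" "\<alpha> - \<mu> > - 1"
    and f: "\<And>t. 0 < t \<Longrightarrow> t \<le> b \<Longrightarrow> f t = (\<Sum>i\<le>N. c i * jacobi_muntz2 b \<alpha> \<beta> \<sigma> \<eta> i t)"
  shows "ek_differentiable b \<sigma> \<eta> \<mu> f"
    and "0 < x \<Longrightarrow> x < b \<Longrightarrow> ek_deriv b \<sigma> \<eta> \<mu> f x =
      (\<Sum>i\<le>N. c i * (Gamma (real i + \<alpha> + 1) / Gamma (real i + \<alpha> - \<mu> + 1)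
         * jacobi_muntz2 b (\<alpha> - \<mu>) (\<beta> + \<mu>) \<sigma> (\<eta> + \<mu>) i x))"
proof -
  \<comment> \<open>Pairs (degree, expansion index) flatten the combination of Jacobi-Muntz
    functions into one power sum, so linearity is built into the index set.\<close>
  define S where "S = (SIGMA i:{..N}. {..i})"
  define a where "a = (\<lambda>(i, l). c i * (jacobi_coeff \<alpha> \<beta> i l * (- 1 / b powr \<sigma>) ^ l))"
  define \<gamma> where "\<gamma> = (\<lambda>(i::nat, l::nat). \<alpha> + real l)"
  have S_sum: "sum F S = (\<Sum>i\<le>N. \<Sum>l\<le>i. F (i, l))" for F :: "nat \<times> nat \<Rightarrow> real"
    by (auto simp: S_def sum.Sigma intro!: sum.cong)
  interpret ek_power_sum b \<sigma> \<eta> \<mu> f S a \<gamma>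
  proof
    fix t assume t: "0 < t" "t \<le> b"
    show "f t = t powr (\<sigma> * \<eta>) * (\<Sum>s\<in>S. a s * (b powr \<sigma> - t powr \<sigma>) powr \<gamma> s)"
      by (simp add: S_sum a_def \<gamma>_def f[OF t] jacobi_muntz2_eq_sum[OF assms(1,2) t]
          sum_distrib_left mult_ac)
  qed (use assms in \<open>auto simp: S_def \<gamma>_def\<close>)
  show "ek_differentiable b \<sigma> \<eta> \<mu> f" by (rule ek_differentiable)
  assume x: "0 < x" "x < b"
  then have "ek_deriv b \<sigma> \<eta> \<mu> f x = x powr (\<sigma> * (\<eta> + \<mu>)) * (\<Sum>i\<le>N. \<Sum>l\<le>i.
      c i * (jacobi_coeff \<alpha> \<beta> i l * (- 1 / b powr \<sigma>) ^ l) *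
      (Gamma (\<alpha> + real l + 1) / Gamma (\<alpha> + real l - \<mu> + 1)) *
      (b powr \<sigma> - x powr \<sigma>) powr (\<alpha> + real l - \<mu>))"
    by (simp add: ek_deriv_eq S_sum a_def \<gamma>_def)
  also have "\<dots> = x powr (\<sigma> * (\<eta> + \<mu>)) * (\<Sum>i\<le>N. \<Sum>l\<le>i.
      c i * (Gamma (real i + \<alpha> + 1) / Gamma (real i + \<alpha> - \<mu> + 1) *
      (jacobi_coeff (\<alpha> - \<mu>) (\<beta> + \<mu>) i l * (- 1 / b powr \<sigma>) ^ l *
      (b powr \<sigma> - x powr \<sigma>) powr (\<alpha> - \<mu> + real l))))"
  proof (rule arg_cong2[where f = "(*)"], rule refl, intro sum.cong refl)
    fix i l :: nat assume "l \<in> {..i}"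
    moreover have "\<alpha> > - 1" using assms by simp
    ultimately have shift: "jacobi_coeff \<alpha> \<beta> i l * (Gamma (\<alpha> + real l + 1) / Gamma (\<alpha> + real l - \<mu> + 1)) =
        Gamma (real i + \<alpha> + 1) / Gamma (real i + \<alpha> - \<mu> + 1) * jacobi_coeff (\<alpha> - \<mu>) (\<beta> + \<mu>) i l"
      using assms(4) by (intro jacobi_coeff_shift) auto
    have move: "c i * (j * p) * G * y = c i * (H * (j' * p * y))" if "j * G = H * j'" for j p G y H j' :: real
    proof -
      have "c i * (j * p) * G * y = c i * p * y * (j * G)" by simp
      then show ?thesis unfolding that by simp
    qed
    have "\<alpha> + real l - \<mu> = \<alpha> - \<mu> + real l" by simp
    then show "c i * (jacobi_coeff \<alpha> \<beta> i l * (- 1 / b powr \<sigma>) ^ l) *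
        (Gamma (\<alpha> + real l + 1) / Gamma (\<alpha> + real l - \<mu> + 1)) *
        (b powr \<sigma> - x powr \<sigma>) powr (\<alpha> + real l - \<mu>) =
        c i * (Gamma (real i + \<alpha> + 1) / Gamma (real i + \<alpha> - \<mu> + 1) *
        (jacobi_coeff (\<alpha> - \<mu>) (\<beta> + \<mu>) i l * (- 1 / b powr \<sigma>) ^ l *
        (b powr \<sigma> - x powr \<sigma>) powr (\<alpha> - \<mu> + real l)))"
      using move[OF shift] by (simp only:)
  qed
  also have "\<dots> = (\<Sum>i\<le>N. c i * (Gamma (real i + \<alpha> + 1) / Gamma (real i + \<alpha> - \<mu> + 1)
         * jacobi_muntz2 b (\<alpha> - \<mu>) (\<beta> + \<mu>) \<sigma> (\<eta> + \<mu>) i x))"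
    using x by (simp add: jacobi_muntz2_eq_sum assms(1,2) sum_distrib_left mult_ac)
  finally show "ek_deriv b \<sigma> \<eta> \<mu> f x = \<dots>" .
qed

section \<open>The interpolant in the Jacobi-Muntz basis\<close>

text \<open>Both sides are the weight \<open>w t\<close> times a polynomial in
  \<open>t powr \<sigma>\<close> of degree at most \<open>N\<close>. These polynomials,
  \<open>Q\<close> and \<open>R\<close>, agree at the \<open>N + 1\<close> distinct points
  \<open>X k\<close>, hence coincide.\<close>

lemma muntz_interpolant2_eq:
  fixes x :: "nat \<Rightarrow> real"
  assumes "0 < b" "0 < \<sigma>"
    and inj: "inj_on x {..N}" and x: "\<And>k. k \<le> N \<Longrightarrow> 0 < x k \<and> x k < b"
    and c: "\<And>k. k \<le> N \<Longrightarrow> (\<Sum>i\<le>N. c i * jacobi_muntz2 b \<alpha> \<beta> \<sigma> \<eta> i (x k)) = u (x k)"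
    and t: "0 < t" "t \<le> b"
  shows "muntz_interpolant2 b \<alpha> \<sigma> \<eta> N x u t = (\<Sum>i\<le>N. c i * jacobi_muntz2 b \<alpha> \<beta> \<sigma> \<eta> i t)"
proof -
  define X where "X k = x k powr \<sigma>" for k
  define w where "w t = t powr (\<sigma> * \<eta>) * (b powr \<sigma> - t powr \<sigma>) powr \<alpha>" for t
  define l where "l i = (\<Prod>j\<in>{..N} - {i}. Polynomial.smult (1 / (X i - X j)) [:- X j, 1:])" for i
  define Q where "Q = (\<Sum>i\<le>N. Polynomial.smult (u (x i) / w (x i)) (l i))"
  \<comment> \<open>The inner linear polynomial expresses the Jacobi argument
    \<open>2 * (t / b) powr \<sigma> - 1\<close> through \<open>t powr \<sigma>\<close>.\<close>
  define R where "R = pcompose (\<Sum>i\<le>N. Polynomial.smult (c i) (jacobi_poly \<alpha> \<beta> i)) [:- 1, 2 / b powr \<sigma>:]"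
  have inj_X: "inj_on X {..N}"
  proof (rule inj_onI)
    fix i j assume ij: "i \<in> {..N}" "j \<in> {..N}" "X i = X j"
    then have "x i = x j"
      using x[of i] x[of j] assms(2) powr_less_mono2[of \<sigma> "x i" "x j"] powr_less_mono2[of \<sigma> "x j" "x i"]
      by (cases "x i" "x j" rule: linorder_cases) (auto simp: X_def)
    then show "i = j" using inj ij by (auto dest: inj_onD)
  qed
  have w: "w (x k) > 0" if "k \<le> N" for k
    using x[OF that] assms(2) powr_less_mono2[of \<sigma> "x k" b] by (auto simp: w_def)
  have poly_l: "poly (l i) (t powr \<sigma>) = muntz_lagrange \<sigma> N x i t" for i t
    by (simp add: l_def muntz_lagrange_def X_def poly_prod diff_divide_distrib)
  have Q: "muntz_interpolant2 b \<alpha> \<sigma> \<eta> N x u t = w t * poly Q (t powr \<sigma>)" if "0 < t" "t \<le> b" for t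
  proof -
    have "b powr \<sigma> - t powr \<sigma> \<ge> 0" using that assms by (auto intro!: powr_mono2)
    moreover have "b powr \<sigma> - x i powr \<sigma> > 0" if "i \<le> N" for i
      using x[OF that] assms by (simp add: powr_less_mono2)
    ultimately show ?thesis
      unfolding muntz_interpolant2_def Q_def poly_sum sum_distrib_left
      using that x by (intro sum.cong refl) (simp add: powr_divide w_def poly_l less_imp_le)
  qed
  have R: "(\<Sum>i\<le>N. c i * jacobi_muntz2 b \<alpha> \<beta> \<sigma> \<eta> i t) = w t * poly R (t powr \<sigma>)" if "0 < t" for t
    using that assms
    by (simp add: R_def jacobi_muntz2_def w_def poly_pcompose poly_sum sum_distrib_left powr_divide mult_ac)
  have lagrange: "muntz_lagrange \<sigma> N x i (x k) = (if i = k then 1 else 0)" if "i \<le> N" "k \<le> N" for i k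
  proof (cases "i = k")
    case True
    have "X k \<noteq> X j" if "j \<in> {..N} - {k}" for j
      using that \<open>k \<le> N\<close> inj_X by (auto dest: inj_onD)
    then show ?thesis
      using True by (auto simp: muntz_lagrange_def X_def intro!: prod.neutral)
  next
    case False
    then show ?thesis
      using that by (auto simp: muntz_lagrange_def intro!: prod_zero bexI[of _ k])
  qed
  have interp: "muntz_interpolant2 b \<alpha> \<sigma> \<eta> N x u (x k) = u (x k)" if k: "k \<le> N" for k
  proof -
    have "muntz_interpolant2 b \<alpha> \<sigma> \<eta> N x u (x k) = (\<Sum>i\<le>N. if i = k then u (x k) else 0)"
      unfolding muntz_interpolant2_def
    proof (intro sum.cong refl)
      fix i assume "i \<in> {..N}"
      moreover have "b powr \<sigma> - x k powr \<sigma> > 0"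
        using x[OF k] assms by (simp add: powr_less_mono2)
      ultimately show "u (x i) * (x k / x i) powr (\<sigma> * \<eta>)
          * ((b powr \<sigma> - x k powr \<sigma>) / (b powr \<sigma> - x i powr \<sigma>)) powr \<alpha> * muntz_lagrange \<sigma> N x i (x k) =
          (if i = k then u (x k) else 0)"
        using lagrange[of i k] x[OF k] k by auto
    qed
    then show ?thesis using k by simp
  qed
  have "poly Q y = poly R y" if "y \<in> X ` {..N}" for y
  proof -
    from that obtain k where k: "k \<le> N" "y = x k powr \<sigma>" by (auto simp: X_def)
    then have "w (x k) * poly Q y = w (x k) * poly R y"
      using Q[of "x k"] R[of "x k"] x[of k] c[of k] interp[of k] by auto
    then show ?thesis using w[OF k(1)] by simp
  qed
  moreover have "degree Q \<le> N"
    unfolding Q_def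
  proof (intro degree_sum_le)
    fix i assume i: "i \<in> {..N}"
    have "degree (l i) \<le> (\<Sum>j\<in>{..N} - {i}. 1)"
      unfolding l_def
      by (rule order.trans[OF degree_prod_sum_le], simp)
        (intro sum_mono, unfold o_apply, rule order.trans[OF degree_smult_le], simp)
    also have "\<dots> = N" using i by simp
    finally show "degree (Polynomial.smult (u (x i) / w (x i)) (l i)) \<le> N"
      by (rule order.trans[OF degree_smult_le])
  qed simp
  moreover have "degree (\<Sum>i\<le>N. Polynomial.smult (c i) (jacobi_poly \<alpha> \<beta> i)) \<le> N"
    by (intro degree_sum_le)
      (auto intro: order.trans[OF degree_smult_le] order.trans[OF degree_jacobi_poly_le])
  then have "degree R \<le> N"
    using assms by (simp add: R_def degree_pcompose)
  ultimately have "Q = R"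
    using card_image[OF inj_X] by (intro poly_eqI_degree[of "X ` {..N}"]) auto
  then show ?thesis using Q[OF t] R[OF t(1)] by simp
qed

section \<open>Matrix inversion and the differentiation matrix\<close>

text \<open>A trivial kernel gives a nonzero determinant, hence a unit of the matrix ring, for which
  \<open>mat_inverse\<close> does not return \<open>None\<close>. This justifies the use of
  \<open>the\<close> in the theorem.\<close>

lemma mat_inverse_nonsingular:
  fixes A :: "'a::field mat"
  assumes A: "A \<in> carrier_mat n n"
    and ker: "\<And>v. v \<in> carrier_vec n \<Longrightarrow> A *\<^sub>v v = 0\<^sub>v n \<Longrightarrow> v = 0\<^sub>v n"
  obtains W where "mat_inverse A = Some W" "A * W = 1\<^sub>m n" "W * A = 1\<^sub>m n" "W \<in> carrier_mat n n"
proof -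
  have "Determinant.det A \<noteq> 0"
    using ker det_0_iff_vec_prod_zero_field[OF A] by blast
  then have "A \<in> Units (ring_mat TYPE('a) n ())"
    by (rule det_non_zero_imp_unit[OF A])
  then obtain W where "mat_inverse A = Some W"
    using mat_inverse(1)[OF A, where b = "()"] by (cases "mat_inverse A") auto
  then show ?thesis
    using mat_inverse(2)[OF A] that by blast
qed

lemma index_mult_mat_sum:
  assumes "A \<in> carrier_mat (N + 1) (N + 1)" "B \<in> carrier_mat (N + 1) (N + 1)" "k \<le> N" "j \<le> N"
  shows "(A * B) $$ (k, j) = (\<Sum>i\<le>N. A $$ (k, i) * B $$ (i, j))"
  using assms by (auto simp: scalar_prod_def atLeast0LessThan lessThan_Suc_atMost intro!: sum.cong)

lemma index_mult_mat_vec_sum: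
  assumes "A \<in> carrier_mat (N + 1) (N + 1)" "v \<in> carrier_vec (N + 1)" "k \<le> N"
  shows "vec_index (A *\<^sub>v v) k = (\<Sum>i\<le>N. A $$ (k, i) * vec_index v i)"
  using assms by (auto simp: scalar_prod_def atLeast0LessThan lessThan_Suc_atMost intro!: sum.cong)

theorem theorem3p21:
  fixes b \<sigma> \<alpha> \<beta> \<eta> \<mu> :: real and N :: nat and z x :: "nat \<Rightarrow> real"
  assumes "b > 0" and "\<sigma> > 0" and "\<alpha> > - 1" and "\<beta> > - 1" and "\<mu> > 0" and "\<alpha> - \<mu> > - 1"
    and "gauss_jacobi_nodes \<alpha> \<beta> N z"
    and "\<And>r. r \<le> N \<Longrightarrow> x r = b * ((1 + z r) / 2) powr (1 / \<sigma>)"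
  shows "invertible_mat (ek_V_mat b \<alpha> \<beta> \<sigma> \<eta> N x) \<and>
         (\<forall>D. ek_diff_matrix b \<alpha> \<sigma> \<eta> \<mu> N x D \<longleftrightarrow>
              D = ek_U_mat b \<alpha> \<beta> \<sigma> \<eta> \<mu> N x * the (mat_inverse (ek_V_mat b \<alpha> \<beta> \<sigma> \<eta> N x)))"
proof -
  let ?V = "ek_V_mat b \<alpha> \<beta> \<sigma> \<eta> N x" and ?U = "ek_U_mat b \<alpha> \<beta> \<sigma> \<eta> \<mu> N x"
  have inj_z: "inj_on z {..N}"
    and z: "- 1 < z k" "z k < 1" if "k \<le> N" for k
    using assms(7) that unfolding gauss_jacobi_nodes_def bij_betw_def by auto
  have x\<sigma>: "(x k / b) powr \<sigma> = (1 + z k) / 2" if "k \<le> N" for k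
    using assms(1,2) assms(8)[OF that] z[OF that] by (simp add: powr_powr)
  have x: "0 < x k \<and> x k < b" if "k \<le> N" for k
  proof -
    have "((1 + z k) / 2) powr (1 / \<sigma>) < 1 powr (1 / \<sigma>)"
      using z[OF that] assms(2) by (intro powr_less_mono2) auto
    then show ?thesis
      using assms(1) assms(8)[OF that] z[OF that] by simp
  qed
  have inj: "inj_on x {..N}"
  proof (rule inj_onI)
    fix i j assume ij: "i \<in> {..N}" "j \<in> {..N}" "x i = x j"
    then have "z i = z j"
      using x\<sigma>[of i] x\<sigma>[of j] by simp
    then show "i = j" using inj_z ij by (auto dest: inj_onD)
  qed
  have V: "?V \<in> carrier_mat (N + 1) (N + 1)" and U: "?U \<in> carrier_mat (N + 1) (N + 1)"
    by (auto simp: ek_V_mat_def ek_U_mat_def)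
  have V_index: "?V $$ (k, i) = jacobi_muntz2 b \<alpha> \<beta> \<sigma> \<eta> i (x k)" if "k \<le> N" "i \<le> N" for k i
    using that by (simp add: ek_V_mat_def)
  have U_index: "?U $$ (k, i) = Gamma (real i + \<alpha> + 1) / Gamma (real i + \<alpha> - \<mu> + 1)
         * jacobi_muntz2 b (\<alpha> - \<mu>) (\<beta> + \<mu>) \<sigma> (\<eta> + \<mu>) i (x k)" if "k \<le> N" "i \<le> N" for k i
    using that by (simp add: ek_U_mat_def)
  \<comment> \<open>After division by the positive weight, a kernel vector of \<open>?V\<close> says
    that the combination \<open>?p\<close> of Jacobi polynomials vanishes at the
    \<open>N + 1\<close> distinct points \<open>z k\<close>. Its degree is at most \<open>N\<close>,
    so it is zero, and independence makes its coefficients zero.\<close>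
  have kernel: "v = 0\<^sub>v (N + 1)" if v: "v \<in> carrier_vec (N + 1)" "?V *\<^sub>v v = 0\<^sub>v (N + 1)" for v
  proof -
    let ?p = "\<Sum>i\<le>N. Polynomial.smult (vec_index v i) (jacobi_poly \<alpha> \<beta> i)"
    have root: "poly ?p (z k) = 0" if k: "k \<le> N" for k
    proof -
      define w where "w = x k powr (\<sigma> * \<eta>) * (b powr \<sigma> - x k powr \<sigma>) powr \<alpha>"
      have arg: "2 * (x k / b) powr \<sigma> - 1 = z k" using x\<sigma>[OF k] by simp
      have "w > 0" using x[OF k] assms(2) powr_less_mono2[of \<sigma> "x k" b] by (auto simp: w_def)
      have "0 = (\<Sum>i\<le>N. ?V $$ (k, i) * vec_index v i)"
        using index_mult_mat_vec_sum[OF V v(1) k] k v(2) by simp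
      also have "\<dots> = w * poly ?p (z k)"
        unfolding poly_sum sum_distrib_left
        by (intro sum.cong refl) (simp add: V_index[OF k] jacobi_muntz2_def arg w_def)
      finally show ?thesis using \<open>w > 0\<close> by simp
    qed
    have "degree ?p \<le> N"
      by (intro degree_sum_le)
        (auto intro: order.trans[OF degree_smult_le] order.trans[OF degree_jacobi_poly_le])
    then have "?p = 0"
      using root card_image[OF inj_z] by (intro poly_eqI_degree[of "z ` {..N}"]) auto
    then have "vec_index v i = 0" if "i \<le> N" for i
      using that assms(3,4)
      by (intro graded_poly_independent[where p = "jacobi_poly \<alpha> \<beta>" and n = N])
        (auto simp: degree_jacobi_poly_le coeff_jacobi_poly_nonzero)
    then show ?thesis using v(1) by auto
  qed
  obtain W where W: "mat_inverse ?V = Some W" "?V * W = 1\<^sub>m (N + 1)" "W * ?V = 1\<^sub>m (N + 1)"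
      "W \<in> carrier_mat (N + 1) (N + 1)"
    using mat_inverse_nonsingular[OF V kernel] by blast
  have "invertible_mat ?V"
    using V W unfolding invertible_mat_def inverts_mat_def by auto
  moreover have UW: "ek_diff_matrix b \<alpha> \<sigma> \<eta> \<mu> N x (?U * W)"
    unfolding ek_diff_matrix_def
  proof (intro conjI allI impI)
    show "?U * W \<in> carrier_mat (N + 1) (N + 1)" using U W(4) by simp
  next
    fix u :: "real \<Rightarrow> real"
    \<comment> \<open>The vector \<open>c\<close> is \<open>W\<close> applied to the nodal values,
      so it solves \<open>?V c = u\<close> at the nodes and gives the coefficients of the
      interpolant. Applying \<open>?U\<close> to it then yields the action of
      \<open>?U * W\<close>.\<close>
    define c where "c i = (\<Sum>j\<le>N. W $$ (i, j) * u (x j))" for i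
    have apply_c: "(\<Sum>i\<le>N. A $$ (k, i) * c i) = (\<Sum>j\<le>N. (A * W) $$ (k, j) * u (x j))"
      if "A \<in> carrier_mat (N + 1) (N + 1)" "k \<le> N" for A k
    proof -
      have "(\<Sum>i\<le>N. A $$ (k, i) * c i) = (\<Sum>j\<le>N. \<Sum>i\<le>N. A $$ (k, i) * (W $$ (i, j) * u (x j)))"
        unfolding c_def sum_distrib_left by (rule sum.swap)
      also have "\<dots> = (\<Sum>j\<le>N. (A * W) $$ (k, j) * u (x j))"
        using index_mult_mat_sum[OF that(1) W(4) that(2)]
        by (intro sum.cong refl) (simp add: sum_distrib_right mult.assoc)
      finally show ?thesis .
    qed
    have "(\<Sum>i\<le>N. c i * jacobi_muntz2 b \<alpha> \<beta> \<sigma> \<eta> i (x k)) = u (x k)" if k: "k \<le> N" for k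
    proof -
      have "(\<Sum>i\<le>N. c i * jacobi_muntz2 b \<alpha> \<beta> \<sigma> \<eta> i (x k)) = (\<Sum>i\<le>N. ?V $$ (k, i) * c i)"
        by (intro sum.cong refl) (simp add: V_index[OF k])
      also have "\<dots> = (\<Sum>j\<le>N. if k = j then u (x j) else 0)"
        unfolding apply_c[OF V k] W(2) using k by (intro sum.cong refl) auto
      finally show ?thesis using k by simp
    qed
    then have "muntz_interpolant2 b \<alpha> \<sigma> \<eta> N x u t = (\<Sum>i\<le>N. c i * jacobi_muntz2 b \<alpha> \<beta> \<sigma> \<eta> i t)"
      if "0 < t" "t \<le> b" for t
      using muntz_interpolant2_eq[OF assms(1,2) inj x] that by blast
    note deriv = ek_deriv_jacobi_muntz2_sum[OF assms(1,2,5,6) this]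
    show "ek_differentiable b \<sigma> \<eta> \<mu> (muntz_interpolant2 b \<alpha> \<sigma> \<eta> N x u)"
      by (rule deriv(1))
    fix k assume k: "k \<le> N"
    have "ek_deriv b \<sigma> \<eta> \<mu> (muntz_interpolant2 b \<alpha> \<sigma> \<eta> N x u) (x k) = (\<Sum>i\<le>N. ?U $$ (k, i) * c i)"
      using x[OF k] by (subst deriv(2)) (auto simp: U_index[OF k] intro!: sum.cong)
    then show "ek_deriv b \<sigma> \<eta> \<mu> (muntz_interpolant2 b \<alpha> \<sigma> \<eta> N x u) (x k)
        = (\<Sum>i\<le>N. (?U * W) $$ (k, i) * u (x i))"
      by (simp add: apply_c[OF U k])
  qed
  moreover have "D = ?U * W" if D: "ek_diff_matrix b \<alpha> \<sigma> \<eta> \<mu> N x D" for D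
  proof (rule eq_matI)
    fix k j assume "k < dim_row (?U * W)" "j < dim_col (?U * W)"
    then have k: "k \<le> N" and j: "j \<le> N" using U W(4) by auto
    \<comment> \<open>Uniqueness is tested on the ordinary Lagrange polynomial for
      \<open>x j\<close>: it is continuous, and its nodal values single out column \<open>j\<close>
      of any differentiation matrix.\<close>
    define u where "u t = (\<Prod>i\<in>{..N} - {j}. (t - x i) / (x j - x i))" for t
    have u: "u (x i) = (if i = j then 1 else 0)" if "i \<le> N" for i
    proof (cases "i = j")
      case True
      have "x j \<noteq> x i" if "i \<in> {..N} - {j}" for i
        using that j inj by (auto dest: inj_onD)
      then show ?thesis using True by (auto simp: u_def intro!: prod.neutral)
    next
      case False
      then show ?thesis using that by (auto simp: u_def intro!: prod_zero bexI[of _ i])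
    qed
    have "continuous_on {0<..<b} u"
      unfolding u_def divide_inverse by (intro continuous_intros)
    then have "(\<Sum>i\<le>N. D $$ (k, i) * u (x i)) = (\<Sum>i\<le>N. (?U * W) $$ (k, i) * u (x i))"
      using D UW k unfolding ek_diff_matrix_def by metis
    moreover have "(\<Sum>i\<le>N. A $$ (k, i) * u (x i)) = A $$ (k, j)" for A :: "real mat"
    proof -
      have "(\<Sum>i\<le>N. A $$ (k, i) * u (x i)) = (\<Sum>i\<le>N. if i = j then A $$ (k, j) else 0)"
        by (intro sum.cong refl) (auto simp: u)
      then show ?thesis using j by simp
    qed
    ultimately show "D $$ (k, j) = (?U * W) $$ (k, j)" by simp
  qed (use D U W(4) in \<open>auto simp: ek_diff_matrix_def\<close>)
  ultimately show ?thesis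
    unfolding W(1) option.sel by blast
qed

end
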